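(* Let $\mathfrak g$ be the centrally extended planar Galilean conformal algebra (in current form) and $\mathfrak g^*$ its regular dual, both as defined in the context. Let $f_0,f_1,f_2,f_3$ be smooth real functions on $S^1$ and let $\vec\gamma={}^t(\gamma_0,\gamma_1,\gamma_2,\gamma_3,a,b)\in\mathfrak g^*$. Then the coadjoint representation of $\mathfrak g$ on $\mathfrak g^*$ leaves the components $a,b$ inert (the $a$- and $b$-components of $X(\vec\gamma)$ are $0$ for every $X\in\mathfrak g$), and its action on the components $(\gamma_0,\gamma_1,\gamma_2,\gamma_3)$ is given by $$L_{f_0}(\vec\gamma)=\begin{pmatrix} a f_0'''+2\gamma_0 f_0'+\gamma_0' f_0\\ 2\gamma_1 f_0'+\gamma_1' f_0\\ 2\gamma_2 f_0'+\gamma_2' f_0\\ \gamma_3 f_0'+\gamma_3' f_0\end{pmatrix},\qquad J_{f_3}(\vec\gamma)=\begin{pmatrix}\gamma_3 f_3'\\ \gamma_2 f_3\\ -\gamma_1 f_3\\ b f_3'\end{pmatrix},$$ $$P^1_{f_1}(\vec\gamma)=\begin{pmatrix}2\gamma_1 f_1'+\gamma_1' f_1\\ 0\\ 0\\ -\gamma_2 f_1\end{pmatrix},\qquad P^2_{f_2}(\vec\gamma)=\begin{pmatrix}2\gamma_2 f_2'+\gamma_2' f_2\\ 0\\ 0\\ \gamma_1 f_2\end{pmatrix}.$$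
   Context: All functions are smooth real-valued functions on $S^1=\mathbb R/2\pi\mathbb Z$ with coordinate $\theta$; a prime denotes $d/d\theta$. The centerless algebra $\mathfrak g_0$ is the Lie algebra of vector fields spanned by $L_f=f(\theta)\partial_\theta+f'(\theta)\sum_{i=1,2}x_i\partial_{x_i}$, $J_f=f(\theta)(x_1\partial_{x_2}-x_2\partial_{x_1})$, $P^i_f=f(\theta)\partial_{x_i}$ ($i=1,2$), $f\in C^\infty(S^1)$. Its brackets are $$[L_f,L_g]=L_{fg'-f'g},\quad [L_f,P^i_g]=P^i_{fg'-f'g},\quad [L_f,J_g]=J_{fg'},$$ $$[J_f,P^i_g]=-\sum_{k=1,2}\epsilon_{ik}P^k_{fg},\quad [J_f,J_g]=[P^i_f,P^j_g]=0,$$ with $\epsilon_{12}=-\epsilon_{21}=1$, $\epsilon_{11}=\epsilon_{22}=0$. The algebra $\mathfrak g=\mathfrak g_0\oplus\mathbb R\oplus\mathbb R$ is the two-dimensional central extension with central elements $C_1,C_2$ whose brackets are those above except for $$[L_f,L_g]=L_{fg'-f'g}-\Big(\int_{S^1}f'''g\,d\theta\Big)C_1,\qquad [J_f,J_g]=\Big(\int_{S^1}f g'\,d\theta\Big)C_2 .$$ An element of $\mathfrak g$ is $X=L_{f_0}+P^1_{f_1}+P^2_{f_2}+J_{f_3}+\alpha C_1+\beta C_2$ with $\alpha,\beta\in\mathbb R$. The regular dual $\mathfrak g^*$ consists of vectors $\vec\gamma={}^t(\gamma_0,\gamma_1,\gamma_2,\gamma_3,a,b)$ with $\gamma_i\in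 C^\infty(S^1)$, $a,b\in\mathbb R$ (standing for $\gamma_0d\theta^2+\gamma_1d\theta^2+\gamma_2d\theta^2+\gamma_3d\theta+a+b$), paired with $\mathfrak g$ by $$\langle\vec\gamma,X\rangle=\sum_{i=0}^3\int_{S^1}\gamma_i f_i\,d\theta+a\alpha+b\beta .$$ The coadjoint action of $X\in\mathfrak g$ on $\gamma\in\mathfrak g^*$ is the element $X(\gamma)\in\mathfrak g^*$ determined by $\langle X(\gamma),Y\rangle=-\langle\gamma,[X,Y]\rangle$ for all $Y\in\mathfrak g$. *)

theory Defs
  imports "HOL-Analysis.Analysis"
begin

definition smooth :: "(real \<Rightarrow> real) \<Rightarrow> bool" where
  "smooth f \<longleftrightarrow> (\<forall>n x. ((deriv ^^ n) f) differentiable (at x))"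

definition smooth_upto :: "nat \<Rightarrow> (real \<Rightarrow> real) \<Rightarrow> bool" where
  "smooth_upto n f \<longleftrightarrow> (\<forall>m\<le>n. \<forall>x. ((deriv ^^ m) f) differentiable (at x))"

lemma smooth_iff_upto: "smooth f \<longleftrightarrow> (\<forall>n. smooth_upto n f)"
  unfolding smooth_def smooth_upto_def by auto

lemma smooth_upto_0: "smooth_upto 0 f \<longleftrightarrow> (\<forall>x. f differentiable (at x))"
  unfolding smooth_upto_def by simp

lemma smooth_upto_Suc:
  "smooth_upto (Suc n) f \<longleftrightarrow> (\<forall>x. f differentiable (at x)) \<and> smooth_upto n (deriv f)"
proof -
  have "(\<forall>m\<le>Suc n. P m) \<longleftrightarrow> P 0 \<and> (\<forall>m\<le>n. P (Suc m))" for P :: "nat \<Rightarrow> bool"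
    by (metis Suc_le_mono le0 not0_implies_Suc)
  then show ?thesis
    unfolding smooth_upto_def by (simp add: funpow_swap1)
qed

lemma smooth_upto_differentiable: "smooth_upto n f \<Longrightarrow> f differentiable (at x)"
  by (cases n) (auto simp: smooth_upto_0 smooth_upto_Suc)

lemma smooth_upto_mono: "smooth_upto n f \<Longrightarrow> m \<le> n \<Longrightarrow> smooth_upto m f"
  unfolding smooth_upto_def by auto

lemma differentiable_has_deriv:
  "f differentiable (at x) \<Longrightarrow> (f has_real_derivative deriv f x) (at x)" for f :: "real \<Rightarrow> real"
  by (metis DERIV_imp_deriv real_differentiableE)

lemma smooth_upto_add:
  "smooth_upto n f \<Longrightarrow> smooth_upto n g \<Longrightarrow> smooth_upto n (\<lambda>x. f x + g x)"
proof (induction n arbitrary: f g)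
  case 0
  then show ?case by (auto simp: smooth_upto_0)
next
  case (Suc n)
  have "deriv (\<lambda>x. f x + g x) = (\<lambda>x. deriv f x + deriv g x)"
    using Suc.prems
    by (auto intro!: ext DERIV_imp_deriv DERIV_add differentiable_has_deriv
        simp: smooth_upto_Suc)
  with Suc show ?case by (auto simp: smooth_upto_Suc)
qed

lemma smooth_upto_mult:
  "smooth_upto n f \<Longrightarrow> smooth_upto n g \<Longrightarrow> smooth_upto n (\<lambda>x. f x * g x)"
proof (induction n arbitrary: f g)
  case 0
  then show ?case by (auto simp: smooth_upto_0)
next
  case (Suc n)
  have fg: "smooth_upto n f" "smooth_upto n g"
    using Suc.prems smooth_upto_mono[of "Suc n" _ n] by auto
  have "deriv (\<lambda>x. f x * g x) = (\<lambda>x. deriv f x * g x + deriv g x * f x)"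
    using Suc.prems
    by (auto intro!: ext DERIV_imp_deriv DERIV_mult differentiable_has_deriv
        simp: smooth_upto_Suc)
  with Suc fg show ?case by (auto simp: smooth_upto_Suc intro!: smooth_upto_add)
qed

lemma smooth_differentiable: "smooth f \<Longrightarrow> f differentiable (at x)"
  using smooth_iff_upto smooth_upto_differentiable by blast

lemma smooth_deriv: "smooth f \<Longrightarrow> smooth (deriv f)"
  using smooth_iff_upto smooth_upto_Suc by blast

lemma smooth_add: "smooth f \<Longrightarrow> smooth g \<Longrightarrow> smooth (\<lambda>x. f x + g x)"
  by (simp add: smooth_iff_upto smooth_upto_add)

lemma smooth_mult: "smooth f \<Longrightarrow> smooth g \<Longrightarrow> smooth (\<lambda>x. f x * g x)"
  by (simp add: smooth_iff_upto smooth_upto_mult)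

lemma smooth_const: "smooth (\<lambda>x. c)"
proof -
  have "smooth_upto n (\<lambda>x. d)" for n and d :: real
    by (induction n arbitrary: d) (auto simp: smooth_upto_0 smooth_upto_Suc)
  then show ?thesis by (simp add: smooth_iff_upto)
qed

lemma smooth_minus: "smooth f \<Longrightarrow> smooth (\<lambda>x. - f x)"
  using smooth_mult[OF smooth_const[of "-1"], of f] by simp

lemma smooth_diff: "smooth f \<Longrightarrow> smooth g \<Longrightarrow> smooth (\<lambda>x. f x - g x)"
  using smooth_add[of f "\<lambda>x. - g x"] smooth_minus[of g] by simp

lemma deriv_periodic:
  fixes f :: "real \<Rightarrow> real"
  assumes "\<And>x. f (x + p) = f x"
  shows "deriv f (x + p) = deriv f x"
proof -
  have "(f has_real_derivative D) (at (x + p)) \<longleftrightarrow> (f has_real_derivative D) (at x)" for D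
    by (simp add: DERIV_shift assms)
  then show ?thesis by (simp add: deriv_def)
qed

text \<open>Functions on \<open>S\<^sup>1 = \<real>/2\<pi>\<int>\<close> are represented by their \<open>2\<pi>\<close>-periodic lifts to \<open>\<real>\<close>.\<close>

typedef circle_fun = "{f. smooth f \<and> (\<forall>\<theta>. f (\<theta> + 2 * pi) = f \<theta>)}"
  morphisms at_angle Circle_fun
  using smooth_const by blast

setup_lifting type_definition_circle_fun

instantiation circle_fun :: "{comm_ring_1, real_algebra_1}"
begin

lift_definition zero_circle_fun :: circle_fun is "\<lambda>\<theta>. 0"
  by (simp add: smooth_const)

lift_definition one_circle_fun :: circle_fun is "\<lambda>\<theta>. 1"
  by (simp add: smooth_const)

lift_definition plus_circle_fun :: "circle_fun \<Rightarrow> circle_fun \<Rightarrow> circle_fun"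
  is "\<lambda>f g \<theta>. f \<theta> + g \<theta>"
  by (simp add: smooth_add)

lift_definition minus_circle_fun :: "circle_fun \<Rightarrow> circle_fun \<Rightarrow> circle_fun"
  is "\<lambda>f g \<theta>. f \<theta> - g \<theta>"
  by (simp add: smooth_diff)

lift_definition uminus_circle_fun :: "circle_fun \<Rightarrow> circle_fun"
  is "\<lambda>f \<theta>. - f \<theta>"
  by (simp add: smooth_minus)

lift_definition times_circle_fun :: "circle_fun \<Rightarrow> circle_fun \<Rightarrow> circle_fun"
  is "\<lambda>f g \<theta>. f \<theta> * g \<theta>"
  by (simp add: smooth_mult)

lift_definition scaleR_circle_fun :: "real \<Rightarrow> circle_fun \<Rightarrow> circle_fun"
  is "\<lambda>c f \<theta>. c * f \<theta>"
  by (simp add: smooth_mult smooth_const)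

instance
  by standard (transfer; auto simp: algebra_simps fun_eq_iff)+

end

lift_definition D :: "circle_fun \<Rightarrow> circle_fun" is deriv
  by (simp add: smooth_deriv deriv_periodic)

definition circle_integral :: "circle_fun \<Rightarrow> real" where
  "circle_integral f = integral {0..2 * pi} (at_angle f)"

lemma at_angle_has_deriv: "(at_angle f has_real_derivative at_angle (D f) \<theta>) (at \<theta>)"
  by transfer (simp add: differentiable_has_deriv smooth_differentiable)

lemma D_add: "D (f + g) = D f + D g"
  by transfer (auto intro!: ext DERIV_imp_deriv DERIV_add differentiable_has_deriv
      smooth_differentiable)

lemma D_mult: "D (f * g) = D f * g + f * D g"
  by transfer (auto intro!: ext DERIV_imp_deriv DERIV_mult' differentiable_has_deriv
      smooth_differentiable simp: add.commute)

lemma D_scaleR: "D (c *\<^sub>R f) = c *\<^sub>R D f"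
  by transfer (auto intro!: ext DERIV_imp_deriv DERIV_cmult differentiable_has_deriv
      smooth_differentiable)

lemma at_angle_integrable: "at_angle f integrable_on {a..b}"
  by (intro integrable_continuous_interval DERIV_continuous_on)
    (rule has_field_derivative_at_within[OF at_angle_has_deriv])

lemma linear_D: "linear D"
  by (simp add: linear_iff D_add D_scaleR)

lemma linear_circle_integral: "linear circle_integral"
proof (rule linearI)
  show "circle_integral (f + g) = circle_integral f + circle_integral g" for f g
    by (simp add: circle_integral_def plus_circle_fun.rep_eq integral_add at_angle_integrable)
  show "circle_integral (c *\<^sub>R f) = c *\<^sub>R circle_integral f" for c f
    by (simp add: circle_integral_def scaleR_circle_fun.rep_eq)
qed

lemma circle_integral_D: "circle_integral (D f) = 0"
proof -
  have "(at_angle (D f) has_integral at_angle f (2 * pi) - at_angle f 0) {0..2 * pi}"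
    by (rule fundamental_theorem_of_calculus)
      (auto simp flip: has_real_derivative_iff_has_vector_derivative
        intro: has_field_derivative_at_within at_angle_has_deriv)
  moreover have "at_angle f (2 * pi) = at_angle f 0"
    using at_angle[of f] by (metis (mono_tags, lifting) add_0 mem_Collect_eq)
  ultimately show ?thesis
    by (simp add: circle_integral_def integral_unique)
qed

text \<open>The tuple \<open>(f\<^sub>0, f\<^sub>1, f\<^sub>2, f\<^sub>3, \<alpha>, \<beta>)\<close> stands for
  \<open>L f\<^sub>0 + P\<^sup>1 f\<^sub>1 + P\<^sup>2 f\<^sub>2 + J f\<^sub>3 + \<alpha> C\<^sub>1 + \<beta> C\<^sub>2\<close>. The vector space structure is that of the
  product type.\<close>

type_synonym gca = "circle_fun \<times> circle_fun \<times> circle_fun \<times> circle_fun \<times> real \<times> real"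

definition L :: "circle_fun \<Rightarrow> gca" where "L f = (f, 0, 0, 0, 0, 0)"
definition P1 :: "circle_fun \<Rightarrow> gca" where "P1 f = (0, f, 0, 0, 0, 0)"
definition P2 :: "circle_fun \<Rightarrow> gca" where "P2 f = (0, 0, f, 0, 0, 0)"
definition J :: "circle_fun \<Rightarrow> gca" where "J f = (0, 0, 0, f, 0, 0)"
definition C1 :: gca where "C1 = (0, 0, 0, 0, 1, 0)"
definition C2 :: gca where "C2 = (0, 0, 0, 0, 0, 1)"

lemma gca_decomposition:
  "(f0, f1, f2, f3, \<alpha>, \<beta>) = L f0 + P1 f1 + P2 f2 + J f3 + \<alpha> *\<^sub>R C1 + \<beta> *\<^sub>R C2"
  by (simp add: L_def P1_def P2_def J_def C1_def C2_def)

text \<open>This is the bilinear antisymmetric extension of the brackets between generators, which are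
  recovered in \<open>bracket_generators\<close> below.\<close>

fun bracket :: "gca \<Rightarrow> gca \<Rightarrow> gca" where
  "bracket (f0, f1, f2, f3, \<alpha>, \<beta>) (g0, g1, g2, g3, \<alpha>', \<beta>') =
    (f0 * D g0 - D f0 * g0,
     (f0 * D g1 - D f0 * g1) - (g0 * D f1 - D g0 * f1) + (f3 * g2 - g3 * f2),
     (f0 * D g2 - D f0 * g2) - (g0 * D f2 - D g0 * f2) - (f3 * g1 - g3 * f1),
     f0 * D g3 - g0 * D f3,
     - circle_integral (D (D (D f0)) * g0),
     circle_integral (f3 * D g3))"

lemma bracket_generators:
  "bracket (L f) (L g) = L (f * D g - D f * g) - circle_integral (D (D (D f)) * g) *\<^sub>R C1"
  "bracket (L f) (P1 g) = P1 (f * D g - D f * g)"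
  "bracket (L f) (P2 g) = P2 (f * D g - D f * g)"
  "bracket (L f) (J g) = J (f * D g)"
  "bracket (J f) (P1 g) = - P2 (f * g)"
  "bracket (J f) (P2 g) = P1 (f * g)"
  "bracket (J f) (J g) = circle_integral (f * D g) *\<^sub>R C2"
  "bracket (P1 f) (P1 g) = 0" "bracket (P1 f) (P2 g) = 0"
  "bracket (P2 f) (P1 g) = 0" "bracket (P2 f) (P2 g) = 0"
  "bracket C1 X = 0" "bracket C2 X = 0"
  by (cases X; simp add: L_def P1_def P2_def J_def C1_def C2_def zero_prod_def
      linear_0[OF linear_D] linear_0[OF linear_circle_integral])+

lemma bilinear_bracket: "bilinear bracket"
proof -
  note lin = linear_add[OF linear_D] linear_scale[OF linear_D]
    linear_add[OF linear_circle_integral] linear_scale[OF linear_circle_integral]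
  show ?thesis
    unfolding bilinear_def
    by (auto intro!: linearI simp: lin algebra_simps)
qed

lemma circle_integral_by_parts: "circle_integral (D f * g) = - circle_integral (f * D g)"
  using circle_integral_D[of "f * g"]
  by (simp add: D_mult linear_add[OF linear_circle_integral])

lemma bracket_antisym: "bracket X Y = - bracket Y X"
proof -
  obtain f0 f1 f2 f3 \<alpha> \<beta> g0 g1 g2 g3 \<alpha>' \<beta>'
    where XY: "X = (f0, f1, f2, f3, \<alpha>, \<beta>)" "Y = (g0, g1, g2, g3, \<alpha>', \<beta>')"
    by (metis prod.exhaust)
  have "circle_integral (D (D (D f0)) * g0) = - circle_integral (f0 * D (D (D g0)))"
    by (simp add: circle_integral_by_parts)
  moreover have "circle_integral (f3 * D g3) = - circle_integral (D f3 * g3)"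
    by (simp add: circle_integral_by_parts)
  ultimately show ?thesis
    by (simp add: XY algebra_simps)
qed

lemma bracket_jacobi:
  "bracket X (bracket Y Z) + bracket Y (bracket Z X) + bracket Z (bracket X Y) = 0"
proof -
  obtain f0 f1 f2 f3 \<alpha> \<beta> g0 g1 g2 g3 \<alpha>' \<beta>' h0 h1 h2 h3 \<alpha>'' \<beta>''
    where XYZ: "X = (f0, f1, f2, f3, \<alpha>, \<beta>)" "Y = (g0, g1, g2, g3, \<alpha>', \<beta>')"
      "Z = (h0, h1, h2, h3, \<alpha>'', \<beta>'')"
    by (metis prod.exhaust)
  note lin = linear_add[OF linear_D] linear_diff[OF linear_D]
  have c1: "D (D (D f0)) * (g0 * D h0 - D g0 * h0) + D (D (D g0)) * (h0 * D f0 - D h0 * f0)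
      + D (D (D h0)) * (f0 * D g0 - D f0 * g0)
    = D (D (D f0) * (g0 * D h0 - D g0 * h0) + D (D g0) * (h0 * D f0 - D h0 * f0)
      + D (D h0) * (f0 * D g0 - D f0 * g0))"
    by (simp add: lin D_mult algebra_simps)
  have c2: "f3 * D (g0 * D h3 - h0 * D g3) + g3 * D (h0 * D f3 - f0 * D h3)
      + h3 * D (f0 * D g3 - g0 * D f3)
    = D (f3 * (g0 * D h3 - h0 * D g3) + g3 * (h0 * D f3 - f0 * D h3)
      + h3 * (f0 * D g3 - g0 * D f3))"
    by (simp add: lin D_mult algebra_simps)
  show ?thesis
    using arg_cong[OF c1, of circle_integral] arg_cong[OF c2, of circle_integral]
    by (simp add: XYZ circle_integral_D linear_add[OF linear_circle_integral]
        zero_prod_def) (simp add: lin D_mult algebra_simps)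
qed

type_synonym gca_dual = "circle_fun \<times> circle_fun \<times> circle_fun \<times> circle_fun \<times> real \<times> real"

fun pairing :: "gca_dual \<Rightarrow> gca \<Rightarrow> real" where
  "pairing (\<gamma>0, \<gamma>1, \<gamma>2, \<gamma>3, a, b) (f0, f1, f2, f3, \<alpha>, \<beta>) =
    circle_integral (\<gamma>0 * f0) + circle_integral (\<gamma>1 * f1) + circle_integral (\<gamma>2 * f2)
    + circle_integral (\<gamma>3 * f3) + a * \<alpha> + b * \<beta>"

definition coad :: "gca \<Rightarrow> gca_dual \<Rightarrow> gca_dual" where
  "coad X \<gamma> = (THE \<delta>. \<forall>Y. pairing \<delta> Y = - pairing \<gamma> (bracket X Y))"

end

theory Submission
  imports Defs "HOL-Library.Periodic_Fun"
begin

text \<open>The integral pairing is nondegenerate because \<open>\<integral> f\<^sup>2 = 0\<close> forces \<open>f = 0\<close>, so the coadjoint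
  action is determined by its defining identity. The two sides of that identity differ by the
  integral of an exact derivative.\<close>

lemma circle_integral_square_eq_0:
  assumes "circle_integral (f * f) = 0"
  shows "f = 0"
proof -
  have cont: "continuous_on {0..2 * pi} (at_angle (f * f))"
    by (intro DERIV_continuous_on)
      (rule has_field_derivative_at_within[OF at_angle_has_deriv])
  have zero: "at_angle f \<theta> = 0" if "\<theta> \<in> {0..2 * pi}" for \<theta>
    using integral_eq_0_iff[OF cont] assms that
    by (auto simp: circle_integral_def times_circle_fun.rep_eq)
  interpret periodic_fun_simple "at_angle f" "2 * pi"
    using at_angle[of f] by unfold_locales simp
  have "at_angle f \<theta> = 0" for \<theta>
  proof -
    \<comment> \<open>\<open>n\<close> counts the whole periods to remove so that the angle lands in
      the base interval covered by \<open>zero\<close>.\<close>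
    define n where "n = \<lfloor>\<theta> / (2 * pi)\<rfloor>"
    have "of_int n \<le> \<theta> / (2 * pi)" "\<theta> / (2 * pi) \<le> of_int n + 1"
      unfolding n_def by linarith+
    then have "\<theta> - of_int n * (2 * pi) \<in> {0..2 * pi}"
      by (simp add: field_simps)
    then show ?thesis
      using zero minus_of_int[of \<theta> n] by simp
  qed
  then show ?thesis
    by (simp add: at_angle_inject[symmetric] zero_circle_fun.rep_eq fun_eq_iff)
qed

text \<open>Each of the generators \<open>L\<close>, \<open>P1\<close>, \<open>P2\<close>,
  \<open>J\<close>, \<open>C1\<close>, \<open>C2\<close> isolates one component of a dual vector, so
  testing on them suffices.\<close>

lemma pairing_nondegenerate:
  assumes "\<And>Y. pairing \<delta> Y = pairing \<epsilon> Y"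
  shows "\<delta> = \<epsilon>"
proof -
  obtain d0 d1 d2 d3 a b where d: "\<delta> = (d0, d1, d2, d3, a, b)"
    by (metis prod.exhaust)
  obtain e0 e1 e2 e3 a' b' where e: "\<epsilon> = (e0, e1, e2, e3, a', b')"
    by (metis prod.exhaust)
  note lin = linear_0[OF linear_circle_integral] linear_diff[OF linear_circle_integral]
  \<comment> \<open>Testing against \<open>x - y\<close> itself turns the hypothesis into a
    vanishing integral of a square.\<close>
  have eq: "x = y" if "\<And>g. circle_integral (x * g) = circle_integral (y * g)" for x y
    using circle_integral_square_eq_0[of "x - y"] that[of "x - y"]
    by (simp add: left_diff_distrib lin)
  have "d0 = e0" by (rule eq) (use assms[of "L _"] in \<open>simp add: d e L_def lin\<close>)
  moreover have "d1 = e1" by (rule eq) (use assms[of "P1 _"] in \<open>simp add: d e P1_def lin\<close>)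
  moreover have "d2 = e2" by (rule eq) (use assms[of "P2 _"] in \<open>simp add: d e P2_def lin\<close>)
  moreover have "d3 = e3" by (rule eq) (use assms[of "J _"] in \<open>simp add: d e J_def lin\<close>)
  moreover have "a = a'" "b = b'"
    using assms[of C1] assms[of C2] by (simp_all add: d e C1_def C2_def lin)
  ultimately show ?thesis by (simp add: d e)
qed

text \<open>\<open>coad\<close> is a definite description: the candidate \<delta> supplies
  existence, nondegeneracy of the pairing supplies uniqueness.\<close>

lemma coad_eqI:
  assumes "\<And>Y. pairing \<delta> Y = - pairing \<gamma> (bracket X Y)"
  shows "coad X \<gamma> = \<delta>"
  unfolding coad_def using assms by (intro the_equality pairing_nondegenerate) auto

text \<open>Treating a general element at once lets a single integration by parts serve all
  generators.\<close>

lemma coad_eq: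
  "coad (f0, f1, f2, f3, \<alpha>, \<beta>) (\<gamma>0, \<gamma>1, \<gamma>2, \<gamma>3, a, b) =
    (a *\<^sub>R D (D (D f0)) + 2 * \<gamma>0 * D f0 + D \<gamma>0 * f0 + 2 * \<gamma>1 * D f1 + D \<gamma>1 * f1
       + 2 * \<gamma>2 * D f2 + D \<gamma>2 * f2 + \<gamma>3 * D f3,
     2 * \<gamma>1 * D f0 + D \<gamma>1 * f0 + \<gamma>2 * f3,
     2 * \<gamma>2 * D f0 + D \<gamma>2 * f0 - \<gamma>1 * f3,
     \<gamma>3 * D f0 + D \<gamma>3 * f0 - \<gamma>2 * f1 + \<gamma>1 * f2 + b *\<^sub>R D f3, 0, 0)"
  (is "coad ?X ?\<gamma> = ?\<delta>")
proof (rule coad_eqI)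
  fix Y :: gca
  obtain g0 g1 g2 g3 \<alpha>' \<beta>' where Y: "Y = (g0, g1, g2, g3, \<alpha>', \<beta>')"
    by (metis prod.exhaust)
  note lin = linear_add[OF linear_circle_integral] linear_diff[OF linear_circle_integral]
    linear_scale[OF linear_circle_integral] linear_neg[OF linear_circle_integral]
  \<comment> \<open>\<open>W\<close> collects the boundary terms from moving every derivative off
    the components of \<open>Y\<close>: the pairing of the claimed value with \<open>Y\<close> plus
    that of \<gamma> with the bracket is the integral of \<open>D W\<close>. The term with
    \<open>a\<close> already has \<open>g0\<close> undifferentiated.\<close>
  define W where "W = \<gamma>0 * f0 * g0 + \<gamma>1 * (f0 * g1 + g0 * f1) + \<gamma>2 * (f0 * g2 + g0 * f2)
    + \<gamma>3 * f0 * g3 + b *\<^sub>R (f3 * g3)"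
  \<comment> \<open>Here \<open>2\<close> inside the integrand is an element of the function ring,
    so it comes out by additivity rather than by \<open>linear_scale\<close>.\<close>
  have two: "circle_integral (x * (y * (z * 2))) = 2 * circle_integral (x * (y * z))" for x y z
    by (simp only: mult_2_right distrib_left linear_add[OF linear_circle_integral])
  have "circle_integral (D W) = 0"
    by (rule circle_integral_D)
  then show "pairing ?\<delta> Y = - pairing ?\<gamma> (bracket ?X Y)"
    by (simp add: W_def Y lin D_mult D_add D_scaleR linear_diff[OF linear_D] algebra_simps two)
qed

theorem proposition2:
  fixes f0 f1 f2 f3 :: circle_fun
    and \<gamma>0 \<gamma>1 \<gamma>2 \<gamma>3 :: circle_fun
    and a b :: real
  shows "(\<forall>X. case coad X (\<gamma>0, \<gamma>1, \<gamma>2, \<gamma>3, a, b) of (_, _, _, _, a', b') \<Rightarrow> a' = 0 \<and> b' = 0) \<and>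
    coad (L f0) (\<gamma>0, \<gamma>1, \<gamma>2, \<gamma>3, a, b) =
      (a *\<^sub>R D (D (D f0)) + 2 * \<gamma>0 * D f0 + D \<gamma>0 * f0,
       2 * \<gamma>1 * D f0 + D \<gamma>1 * f0,
       2 * \<gamma>2 * D f0 + D \<gamma>2 * f0,
       \<gamma>3 * D f0 + D \<gamma>3 * f0,
       0, 0) \<and>
    coad (J f3) (\<gamma>0, \<gamma>1, \<gamma>2, \<gamma>3, a, b) =
      (\<gamma>3 * D f3, \<gamma>2 * f3, - \<gamma>1 * f3, b *\<^sub>R D f3, 0, 0) \<and>
    coad (P1 f1) (\<gamma>0, \<gamma>1, \<gamma>2, \<gamma>3, a, b) =
      (2 * \<gamma>1 * D f1 + D \<gamma>1 * f1, 0, 0, - \<gamma>2 * f1, 0, 0) \<and>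
    coad (P2 f2) (\<gamma>0, \<gamma>1, \<gamma>2, \<gamma>3, a, b) =
      (2 * \<gamma>2 * D f2 + D \<gamma>2 * f2, 0, 0, \<gamma>1 * f2, 0, 0)"
proof (intro conjI allI)
  fix X
  show "case coad X (\<gamma>0, \<gamma>1, \<gamma>2, \<gamma>3, a, b) of (_, _, _, _, a', b') \<Rightarrow> a' = 0 \<and> b' = 0"
    by (cases X) (simp add: coad_eq)
\<comment> \<open>A generator has all other components zero, and \<open>D 0 = 0\<close> removes
  their terms from the general formula.\<close>
qed (simp_all add: coad_eq L_def P1_def P2_def J_def linear_0[OF linear_D])

end
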